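(* Suppose $n \geq 3$ is prime and $r \in \{0,1,2,\ldots,n-1\}$. - $rl(n,r) > 0$ if and only if $r$ is even and $r \neq (n-1)/2$. - $crl(n,r) > 0$ if and only if $r$ is even and $r > (n-1)/2$.
   Context: All graphs are finite, simple, undirected, unweighted, and loopless. A regular graph is integral if all eigenvalues of its adjacency matrix are integers (for regular graphs this is equivalent to all eigenvalues of its Laplacian matrix being integers). $rl(n,r)$ denotes the number, up to isomorphism, of (not necessarily connected) $r$-regular integral graphs on $n$ vertices, and $crl(n,r)$ denotes the number, up to isomorphism, of connected $r$-regular integral graphs on $n$ vertices. *)

theory Defs
  imports
    "Graph_Theory.Graph_Theory"
    "Jordan_Normal_Form.Char_Poly"
    "HOL-Computational_Algebra.Primes"
    Complex_Main
begin

text \<open>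
  The locale \<^locale>\<open>pair_graph\<close> describes finite loopless symmetric digraphs without
  parallel arcs: an undirected edge \<open>uv\<close> is represented by the two arcs \<open>(u, v)\<close> and \<open>(v, u)\<close>,
  so the degree of a vertex is its out-degree.
\<close>

definition labelled_graphs :: "nat \<Rightarrow> nat pair_pre_digraph set" where
  "labelled_graphs n = {G. pair_graph G \<and> pverts G = {0..<n}}"

definition regular :: "nat \<Rightarrow> 'a pair_pre_digraph \<Rightarrow> bool" where
  "regular r G \<longleftrightarrow> (\<forall>v\<in>pverts G. out_degree (with_proj G) v = r)"

definition adjacency_matrix :: "nat \<Rightarrow> nat pair_pre_digraph \<Rightarrow> complex mat" where
  "adjacency_matrix n G = mat n n (\<lambda>(i, j). if (i, j) \<in> parcs G then 1 else 0)"

definition integral_graph :: "nat \<Rightarrow> nat pair_pre_digraph \<Rightarrow> bool" where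
  "integral_graph n G \<longleftrightarrow> (\<forall>k. eigenvalue (adjacency_matrix n G) k \<longrightarrow> k \<in> \<int>)"

definition regular_integral_graphs :: "nat \<Rightarrow> nat \<Rightarrow> nat pair_pre_digraph set" where
  "regular_integral_graphs n r = {G \<in> labelled_graphs n. regular r G \<and> integral_graph n G}"

definition connected_regular_integral_graphs :: "nat \<Rightarrow> nat \<Rightarrow> nat pair_pre_digraph set" where
  "connected_regular_integral_graphs n r =
     {G \<in> regular_integral_graphs n r. Digraph_Component.connected (with_proj G)}"

definition iso_rel :: "'a pair_pre_digraph set \<Rightarrow> ('a pair_pre_digraph \<times> 'a pair_pre_digraph) set" where
  "iso_rel S = {(G, H). G \<in> S \<and> H \<in> S \<and> digraph_iso (with_proj G) (with_proj H)}"

text \<open>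
  Every graph on \<open>n\<close> vertices is isomorphic to one with vertex set \<open>{0..<n}\<close>, so counting
  isomorphism classes of the latter counts all graphs up to isomorphism.
\<close>

definition rl :: "nat \<Rightarrow> nat \<Rightarrow> nat" where
  "rl n r = card (regular_integral_graphs n r // iso_rel (regular_integral_graphs n r))"

definition crl :: "nat \<Rightarrow> nat \<Rightarrow> nat" where
  "crl n r = card (connected_regular_integral_graphs n r
     // iso_rel (connected_regular_integral_graphs n r))"

lemma finite_labelled_graphs: "finite (labelled_graphs n)"
proof (rule finite_subset)
  show "labelled_graphs n \<subseteq>
    (\<lambda>E. \<lparr>pverts = {0..<n}, parcs = E\<rparr>) ` Pow ({0..<n} \<times> {0..<n})"
  proof
    fix G assume "G \<in> labelled_graphs n"
    then have G: "pair_graph G" "pverts G = {0..<n}" by (auto simp: labelled_graphs_def)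
    interpret pair_graph G by (fact G)
    have "parcs G \<subseteq> {0..<n} \<times> {0..<n}"
      using in_arcsD1 in_arcsD2 G(2) by fastforce
    then show "G \<in> (\<lambda>E. \<lparr>pverts = {0..<n}, parcs = E\<rparr>) ` Pow ({0..<n} \<times> {0..<n})"
      using G(2) by (intro image_eqI[of _ _ "parcs G"]) auto
  qed
qed simp

lemma equiv_iso_rel:
  assumes "S \<subseteq> labelled_graphs n"
  shows "equiv S (iso_rel S)"
proof -
  have wf: "wf_digraph (with_proj G)" if "G \<in> S" for G
  proof -
    interpret pair_graph G using that assms by (auto simp: labelled_graphs_def)
    show ?thesis by unfold_locales
  qed
  show ?thesis
  proof (rule equivI)
    show "iso_rel S \<subseteq> S \<times> S" by (auto simp: iso_rel_def)
    show "refl_on S (iso_rel S)"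
    proof (rule refl_onI)
      fix G assume G: "G \<in> S"
      let ?h = "\<lparr>iso_verts = id, iso_arcs = id, iso_head = snd, iso_tail = fst\<rparr>"
      have "pre_digraph.digraph_isomorphism (with_proj G) ?h"
        using wf[OF G] by (simp add: pre_digraph.digraph_isomorphism_def)
      moreover have "with_proj G = app_iso ?h (with_proj G)"
        by (simp add: app_iso_def with_proj_def)
      ultimately show "(G, G) \<in> iso_rel S"
        using G unfolding iso_rel_def digraph_iso_def by blast
    qed
    show "sym (iso_rel S)"
      using wf digraph_iso_swap by (fastforce simp: sym_def iso_rel_def)
    show "trans (iso_rel S)"
      using digraph_iso_trans by (fastforce simp: trans_def iso_rel_def)
  qed
qed

end

theory Submission
  imports Defs
begin

text \<open>
  \<^bold>\<open>The obstruction.\<close> Let \<open>A\<close> be the adjacency matrix of a connected \<open>r\<close>-regular integral graph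
  of order \<open>n\<close>. Take a shortest product of factors \<open>A - l\<close> that kills the indicator \<open>\<delta>\<close> of one
  vertex. Minimality makes every \<open>l\<close> in it an eigenvalue, hence an integer with \<open>\<bar>l\<bar> \<le> r\<close>. As each
  factor \<open>A - l\<close> multiplies the sum of the entries of a vector by \<open>r - l\<close>, and this sum is \<open>1\<close> for
  \<open>\<delta>\<close>, some \<open>l\<close> equals \<open>r\<close>. Leaving out that factor gives an integer eigenvector for \<open>r\<close>, which is
  constant, say \<open>c \<noteq> 0\<close>, because the graph is connected. Comparing sums, \<open>n c = \<Prod> (r - l)\<close> over the
  remaining \<open>l\<close>. So if \<open>n\<close> is prime it divides some nonzero \<open>r - l \<le> 2 r\<close>, and \<open>n \<le> 2 r\<close>
  (\<open>connected_integral_prime_order\<close>). This is a form of Hoffman's identity expressing the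
  all-ones matrix as a polynomial in \<open>A\<close>.

  Every \<open>r\<close>-regular graph with \<open>n \<le> 2 r + 1\<close> is connected, since two nonadjacent vertices have a
  common neighbour (\<open>dense_connected\<close>). Hence \<open>n = 2 r + 1\<close> is impossible for prime \<open>n\<close>, connected
  or not, and for \<open>n < 2 r + 1\<close> connectedness costs nothing. Evenness of \<open>r\<close> is the handshake
  lemma.

  \<^bold>\<open>The construction.\<close> Regular integral graphs are closed under complement and under disjoint
  union of graphs of equal degree. Write \<open>A = r + 1\<close> and \<open>B = n - r\<close>. Complementing exchanges \<open>A\<close>
  and \<open>B\<close>; adding a component \<open>K\<^sub>A\<close> replaces \<open>B\<close> by \<open>A + B\<close>. Reading these moves backwards is the
  subtractive Euclidean algorithm on \<open>(A, B)\<close>, which could only get stuck at \<open>A = B > 1\<close>, coming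
  from \<open>B = 2 A\<close>. There one removes a cocktail party graph of order \<open>A + 1\<close> instead and is left
  with the pair \<open>(A, A - 1)\<close> (\<open>realizable_pair\<close>).
\<close>

section \<open>Regular relations and their adjacency operator\<close>

definition nbr :: "nat \<Rightarrow> (nat \<Rightarrow> nat \<Rightarrow> bool) \<Rightarrow> nat \<Rightarrow> nat set" where
  "nbr n E v = {u. u < n \<and> E v u}"

definition adj :: "nat \<Rightarrow> (nat \<Rightarrow> nat \<Rightarrow> bool) \<Rightarrow> (nat \<Rightarrow> complex) \<Rightarrow> nat \<Rightarrow> complex" where
  "adj n E f v = (\<Sum>u\<in>nbr n E v. f u)"

text \<open>
  Only the values of a vector on \<open>{..<n}\<close> count, so an eigenvector must be nonzero there.
\<close>

definition integral_spectrum :: "nat \<Rightarrow> (nat \<Rightarrow> nat \<Rightarrow> bool) \<Rightarrow> bool" where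
  "integral_spectrum n E \<longleftrightarrow>
     (\<forall>k f. (\<exists>v<n. f v \<noteq> 0) \<longrightarrow> (\<forall>v<n. adj n E f v = k * f v) \<longrightarrow> k \<in> \<int>)"

lemma integral_spectrumD:
  assumes "integral_spectrum n E" "v < n" "f v \<noteq> 0" "\<And>v. v < n \<Longrightarrow> adj n E f v = k * f v"
  shows "k \<in> \<int>"
  using assms unfolding integral_spectrum_def by blast

locale regular_relation =
  fixes n :: nat and E :: "nat \<Rightarrow> nat \<Rightarrow> bool" and r :: nat
  assumes sym: "E u v \<Longrightarrow> E v u"
    and irrefl: "\<not> E v v"
    and degree: "v < n \<Longrightarrow> card (nbr n E v) = r"

lemma finite_nbr [simp]: "finite (nbr n E v)"
  by (simp add: nbr_def)

context regular_relation
begin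

text \<open>
  The all-ones vector is a left eigenvector for \<open>r\<close> because the relation is symmetric, so that
  column sums are degrees as well.
\<close>

lemma sum_adj: "(\<Sum>v<n. adj n E f v) = of_nat r * (\<Sum>v<n. f v)"
proof -
  have "nbr n E v = {..<n} \<inter> {u. E v u}" for v
    by (auto simp: nbr_def)
  then have "(\<Sum>v<n. adj n E f v) = (\<Sum>v<n. \<Sum>u<n. if E v u then f u else 0)"
    by (simp add: adj_def sum.If_cases)
  also have "\<dots> = (\<Sum>u<n. \<Sum>v<n. if E v u then f u else 0)"
    by (rule sum.swap)
  also have "\<dots> = (\<Sum>u<n. of_nat (card (nbr n E u)) * f u)"
  proof (intro sum.cong refl)
    fix u
    have "{..<n} \<inter> {v. E v u} = nbr n E u"
      using sym by (auto simp: nbr_def)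
    then show "(\<Sum>v<n. if E v u then f u else 0) = of_nat (card (nbr n E u)) * f u"
      by (simp add: sum.If_cases)
  qed
  also have "\<dots> = of_nat r * (\<Sum>v<n. f v)"
    by (simp add: degree sum_distrib_left)
  finally show ?thesis .
qed

lemma even_order_times_degree: "even (n * r)"
proof -
  define L where "L = {(u, v). u < v \<and> u < n \<and> v < n \<and> E u v}"
  have L: "finite L"
    by (rule finite_subset[of _ "{..<n} \<times> {..<n}"]) (auto simp: L_def)
  have swap: "prod.swap ` L = {(u, v). v < u \<and> u < n \<and> v < n \<and> E u v}"
    using sym by (auto simp: L_def image_iff)
  have "n * r = (\<Sum>v<n. card (nbr n E v))"
    by (simp add: degree)
  also have "\<dots> = card (SIGMA v:{..<n}. nbr n E v)"
    by simp
  also have "(SIGMA v:{..<n}. nbr n E v) = L \<union> prod.swap ` L"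
    unfolding swap using irrefl by (auto simp: L_def nbr_def) (metis linorder_neqE_nat)
  also have "card \<dots> = card L + card (prod.swap ` L)"
    using L by (intro card_Un_disjoint) (auto simp: L_def)
  also have "card (prod.swap ` L) = card L"
    by (rule card_image) simp
  finally show ?thesis
    by simp
qed

text \<open>
  Evaluate the eigenvalue equation at a vertex where the eigenvector has maximal modulus.
\<close>

lemma norm_eigenvalue_le:
  assumes "v < n" "f v \<noteq> 0" and eig: "\<And>v. v < n \<Longrightarrow> adj n E f v = k * f v"
  shows "norm k \<le> real r"
proof -
  let ?m = "Max ((\<lambda>v. norm (f v)) ` {..<n})"
  have le: "norm (f u) \<le> ?m" if "u < n" for u
    using that by (intro Max_ge) auto
  have "?m \<in> (\<lambda>v. norm (f v)) ` {..<n}"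
    using \<open>v < n\<close> by (intro Max_in) auto
  then obtain x where x: "x < n" "?m = norm (f x)"
    by auto
  have "norm k * ?m = norm (adj n E f x)"
    using eig x by (simp add: norm_mult)
  also have "\<dots> \<le> (\<Sum>u\<in>nbr n E x. norm (f u))"
    unfolding adj_def by (rule norm_sum)
  also have "\<dots> \<le> (\<Sum>u\<in>nbr n E x. ?m)"
    by (intro sum_mono le) (auto simp: nbr_def)
  also have "\<dots> = real r * ?m"
    using degree x by simp
  finally have "norm k * ?m \<le> real r * ?m" .
  moreover have "?m > 0"
    using le[OF \<open>v < n\<close>] \<open>f v \<noteq> 0\<close> by (smt (verit) norm_le_zero_iff)
  ultimately show ?thesis
    by simp
qed

text \<open>
  Maximum principle: at a vertex where \<open>g\<close> is maximal, \<open>g\<close> is the average of its values at the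
  neighbours, so these are maximal too, and the maximum spreads over the connected graph.
\<close>

lemma harmonic_constant:
  fixes g :: "nat \<Rightarrow> real"
  assumes conn: "\<And>u v. u < n \<Longrightarrow> v < n \<Longrightarrow> (\<lambda>a b. b \<in> nbr n E a)\<^sup>*\<^sup>* u v"
    and harm: "\<And>v. v < n \<Longrightarrow> (\<Sum>u\<in>nbr n E v. g u) = real r * g v"
    and "u < n" "v < n"
  shows "g u = g v"
proof -
  let ?m = "Max (g ` {..<n})"
  have le: "g u \<le> ?m" if "u < n" for u
    using that by (intro Max_ge) auto
  have "?m \<in> g ` {..<n}"
    using \<open>u < n\<close> by (intro Max_in) auto
  then obtain x where x: "x < n" "g x = ?m"
    by auto
  have "g y = ?m" if "y < n" for y
  proof -
    have "(\<lambda>a b. b \<in> nbr n E a)\<^sup>*\<^sup>* x y"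
      using conn x that by blast
    then have "y < n \<and> g y = ?m"
    proof induction
      case base
      then show ?case using x by simp
    next
      case (step y z)
      then have y: "y < n" "g y = ?m" by auto
      have "(\<Sum>u\<in>nbr n E y. ?m - g u) = 0"
        using harm[OF y(1)] y degree by (simp add: sum_subtractf)
      moreover have "\<forall>u\<in>nbr n E y. 0 \<le> ?m - g u"
        using le by (auto simp: nbr_def)
      ultimately have "?m - g z = 0"
        using step.hyps(2) by (subst (asm) sum_nonneg_eq_0_iff) auto
      then show ?case
        using step.hyps(2) by (auto simp: nbr_def)
    qed
    then show ?thesis by simp
  qed
  then show ?thesis using assms by simp
qed

text \<open>
  Two distinct nonadjacent vertices with disjoint neighbourhoods would need \<open>2 r + 2\<close> vertices.
\<close>

lemma dense_connected:
  assumes "n \<le> 2 * r + 1" "u < n" "v < n"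
  shows "(\<lambda>a b. b \<in> nbr n E a)\<^sup>*\<^sup>* u v"
proof (cases "u = v \<or> E u v")
  case True
  then show ?thesis using assms by (auto simp: nbr_def)
next
  case False
  have "nbr n E u \<inter> nbr n E v \<noteq> {}"
  proof
    assume disj: "nbr n E u \<inter> nbr n E v = {}"
    have "nbr n E u \<union> nbr n E v \<subseteq> {..<n} - {u, v}"
      using False irrefl sym by (auto simp: nbr_def)
    then have "card (nbr n E u \<union> nbr n E v) \<le> card ({..<n} - {u, v})"
      by (intro card_mono) auto
    also have "\<dots> = n - 2"
      using False assms by (subst card_Diff_subset) auto
    also have "card (nbr n E u \<union> nbr n E v) = 2 * r"
      using disj assms degree by (subst card_Un_disjoint) auto
    finally show False
      using assms False by linarith
  qed
  then obtain w where "w \<in> nbr n E u" "v \<in> nbr n E w"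
    using assms sym by (auto simp: nbr_def)
  then show ?thesis
    by (meson converse_rtranclp_into_rtranclp r_into_rtranclp)
qed

end

section \<open>Annihilating a vector by shifted adjacency operators\<close>

text \<open>
  \<open>shift n E l\<close> is \<open>A - l\<close> for the adjacency operator \<open>A\<close>. These operators commute, so a product
  of them may be indexed by a multiset, and any factor can be taken as the last one applied.
\<close>

definition shift :: "nat \<Rightarrow> (nat \<Rightarrow> nat \<Rightarrow> bool) \<Rightarrow> complex \<Rightarrow> (nat \<Rightarrow> complex) \<Rightarrow> nat \<Rightarrow> complex"
  where "shift n E l f v = adj n E f v - l * f v"

text \<open>
  The vector \<open>p(A) f\<close>, by Horner's scheme.
\<close>

definition poly_act ::
    "nat \<Rightarrow> (nat \<Rightarrow> nat \<Rightarrow> bool) \<Rightarrow> complex poly \<Rightarrow> (nat \<Rightarrow> complex) \<Rightarrow> nat \<Rightarrow> complex"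
  where "poly_act n E p f = fold_coeffs (\<lambda>a g v. a * f v + adj n E g v) p (\<lambda>v. 0)"

lemma adj_linear [simp]:
  "adj n E (\<lambda>v. 0) = (\<lambda>v. 0)"
  "adj n E (\<lambda>v. f v + g v) = (\<lambda>v. adj n E f v + adj n E g v)"
  "adj n E (\<lambda>v. f v - g v) = (\<lambda>v. adj n E f v - adj n E g v)"
  "adj n E (\<lambda>v. c * f v) = (\<lambda>v. c * adj n E f v)"
  by (auto simp: adj_def sum.distrib sum_subtractf sum_distrib_left)

lemma comp_fun_commute_shift: "comp_fun_commute (shift n E)"
proof
  fix a b
  show "shift n E a \<circ> shift n E b = shift n E b \<circ> shift n E a"
    by (auto simp: fun_eq_iff shift_def [abs_def] algebra_simps)
qed

interpretation shift: comp_fun_commute "shift n E" for n E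
  by (rule comp_fun_commute_shift)

lemma poly_act_0: "poly_act n E 0 f = (\<lambda>v. 0)"
  by (simp add: poly_act_def)

lemma poly_act_pCons: "poly_act n E (pCons a p) f = (\<lambda>v. a * f v + adj n E (poly_act n E p f) v)"
  by (cases "p = 0 \<and> a = 0") (auto simp: poly_act_def)

lemma poly_act_smult: "poly_act n E (Polynomial.smult c p) f = (\<lambda>v. c * poly_act n E p f v)"
  by (induction p) (auto simp: poly_act_0 poly_act_pCons algebra_simps)

lemma poly_act_add: "poly_act n E (p + q) f = (\<lambda>v. poly_act n E p f v + poly_act n E q f v)"
  by (induction p q rule: poly_induct2) (auto simp: poly_act_0 poly_act_pCons algebra_simps)

lemma poly_act_linear_factor:
  "poly_act n E ([:- a, 1:] * p) f = shift n E a (poly_act n E p f)"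
proof -
  have "[:- a, 1:] * p = pCons 0 p + Polynomial.smult (- a) p"
    by simp
  then show ?thesis
    by (simp only: poly_act_add poly_act_smult poly_act_pCons) (auto simp: shift_def)
qed

lemma poly_act_split:
  "poly_act n E (\<Prod>a\<leftarrow>as. [:- a, 1:]) f = fold_mset (shift n E) f (mset as)"
proof (induction as)
  case Nil
  show ?case by (simp add: one_pCons poly_act_pCons poly_act_0)
next
  case (Cons a as)
  then show ?case by (simp only: poly_act_linear_factor list.map prod_list.Cons mset.simps shift.fold_mset_add_mset)
qed

lemma poly_act_Poly:
  "poly_act n E (Poly cs) f v = (\<Sum>i<length cs. cs ! i * (adj n E ^^ i) f v)"
proof (induction cs arbitrary: v)
  case Nil
  show ?case by (simp add: poly_act_0)
next
  case (Cons c cs)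
  then have "poly_act n E (Poly cs) f = (\<lambda>v. \<Sum>i<length cs. cs ! i * (adj n E ^^ i) f v)"
    by auto
  moreover have "adj n E (\<lambda>v. \<Sum>i\<in>I. h i v) = (\<lambda>v. \<Sum>i\<in>I. adj n E (h i) v)" for I :: "nat set" and h
    unfolding adj_def by (rule ext) (rule sum.swap)
  ultimately show ?case
    by (simp add: poly_act_pCons sum.lessThan_Suc_shift del: sum.lessThan_Suc)
qed

text \<open>
  The \<open>n + 1\<close> vectors \<open>f, A f, \<dots>, A\<^sup>n f\<close> in an \<open>n\<close>-dimensional space are linearly dependent. A
  dependence is a nonzero polynomial \<open>p\<close> with \<open>p(A) f = 0\<close>, and \<open>p\<close> splits over the complex
  numbers.
\<close>

lemma exists_annihilating_shifts: "\<exists>M. \<forall>v<n. fold_mset (shift n E) f M v = 0"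
proof -
  \<comment> \<open>A row of zeros makes the matrix of the \<open>n + 1\<close> columns square and its determinant zero.\<close>
  let ?A = "mat (Suc n) (Suc n) (\<lambda>(v, i). if v < n then (adj n E ^^ i) f v else 0)"
  have "?A = mat\<^sub>r (Suc n) (Suc n)
      (\<lambda>v. if v = n then 0\<^sub>v (Suc n) else vec (Suc n) (\<lambda>i. (adj n E ^^ i) f v))"
    by (rule eq_matI) auto
  also have "det \<dots> = 0"
    by (rule det_row_0) auto
  finally have "det ?A = 0" .
  then obtain c where c: "c \<in> carrier_vec (Suc n)" "c \<noteq> 0\<^sub>v (Suc n)" "?A *\<^sub>v c = 0\<^sub>v (Suc n)"
    using det_0_iff_vec_prod_zero[of ?A "Suc n"] by auto
  let ?p = "Poly (list_of_vec c)"
  have act: "poly_act n E ?p f v = 0" if "v < n" for v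
  proof -
    have "0 = (?A *\<^sub>v c) $ v"
      using c that by simp
    also have "\<dots> = (\<Sum>i<Suc n. (adj n E ^^ i) f v * c $ i)"
      using c(1) that by (simp add: scalar_prod_def atLeast0LessThan del: sum.lessThan_Suc)
    also have "\<dots> = poly_act n E ?p f v"
      using c(1) by (auto simp: poly_act_Poly list_of_vec_index mult.commute simp del: sum.lessThan_Suc intro!: sum.cong)
    finally show ?thesis by simp
  qed
  have "?p \<noteq> 0"
  proof
    assume "?p = 0"
    then have "list_of_vec c ! i = 0" if "i < Suc n" for i
      using that c(1) by (metis Poly_eq_0 carrier_vecD in_set_conv_nth in_set_replicate length_list_of_vec)
    then have "c = 0\<^sub>v (Suc n)"
      using c(1) by (intro eq_vecI) (auto simp: list_of_vec_index)
    with c(2) show False ..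
  qed
  obtain as where as: "?p = Polynomial.smult (lead_coeff ?p) (\<Prod>a\<leftarrow>as. [:- a, 1:])"
    using fundamental_theorem_algebra_factorized[of ?p] by metis
  have "poly_act n E ?p f v = lead_coeff ?p * fold_mset (shift n E) f (mset as) v" for v
    using arg_cong[OF as, of "\<lambda>p. poly_act n E p f v"]
    by (simp only: poly_act_smult poly_act_split)
  moreover have "lead_coeff ?p \<noteq> 0"
    using \<open>?p \<noteq> 0\<close> by (simp only: leading_coeff_0_iff not_False_eq_True)
  ultimately show ?thesis
    using act by (metis mult_eq_0_iff)
qed

lemma fold_shift_Ints:
  assumes "\<And>l. l \<in># M \<Longrightarrow> l \<in> \<int>" "\<And>v. f v \<in> \<int>"
  shows "fold_mset (shift n E) f M v \<in> \<int>"
  using assms(1)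
proof (induction M arbitrary: v)
  case empty
  then show ?case by (simp add: assms)
next
  case (add l M)
  then show ?case
    by (auto simp: shift_def [of n E l] adj_def intro!: Ints_diff Ints_mult Ints_sum)
qed

context regular_relation
begin

text \<open>
  The sum of the entries is a linear functional that \<open>A - l\<close> multiplies by \<open>r - l\<close>.
\<close>

lemma sum_fold_shift:
  "(\<Sum>v<n. fold_mset (shift n E) f M v) = (\<Prod>l\<in>#M. of_nat r - l) * (\<Sum>v<n. f v)"
proof (induction M)
  case empty
  show ?case by simp
next
  case (add l M)
  have "(\<Sum>v<n. fold_mset (shift n E) f (add_mset l M) v)
      = (of_nat r - l) * (\<Sum>v<n. fold_mset (shift n E) f M v)"
    by (simp add: shift_def sum_subtractf sum_adj sum_distrib_left [symmetric] algebra_simps)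
  then show ?case by (simp add: add.IH)
qed

text \<open>
  The divisibility \<open>n dvd (\<Prod>l\<in>#N. r - l)\<close> for a multiset \<open>N\<close> of eigenvalues with nonzero product
  holds for every order \<open>n\<close>; primality picks a single factor, which is at most \<open>2 r\<close>.
\<close>

lemma connected_integral_prime_order:
  assumes conn: "\<And>u v. u < n \<Longrightarrow> v < n \<Longrightarrow> (\<lambda>a b. b \<in> nbr n E a)\<^sup>*\<^sup>* u v"
    and int: "integral_spectrum n E" and "prime n"
  shows "n \<le> 2 * r"
proof -
  have n0: "0 < n"
    using \<open>prime n\<close> prime_gt_0_nat by blast
  define \<delta> :: "nat \<Rightarrow> complex" where "\<delta> = (\<lambda>v. of_bool (v = 0))"
  define kills where "kills M \<longleftrightarrow> (\<forall>v<n. fold_mset (shift n E) \<delta> M v = 0)" for M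
  have sum\<delta>: "(\<Sum>v<n. \<delta> v) = 1"
    using n0 by (simp add: \<delta>_def of_bool_def)
  obtain M where M: "kills M" and min: "\<And>M'. size M' < size M \<Longrightarrow> \<not> kills M'"
    using exists_least_iff[of "\<lambda>k. \<exists>M. size M = k \<and> kills M"] exists_annihilating_shifts
    unfolding kills_def by (metis (no_types, lifting))
  \<comment> \<open>Dropping any one factor from the shortest product leaves an eigenvector for its shift.\<close>
  have eig: "(\<exists>v<n. w v \<noteq> 0) \<and> (\<forall>v<n. adj n E w v = l * w v)"
    if "M = add_mset l M'" "w = fold_mset (shift n E) \<delta> M'" for l M' w
    using min[of M'] M that by (auto simp: kills_def shift_def)
  have ev: "l \<in> \<int> \<and> norm l \<le> real r" if "l \<in># M" for l
    using eig[of l "M - {#l#}"] that int norm_eigenvalue_le integral_spectrumD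
    by (metis insert_DiffM)
  have "(\<Prod>l\<in>#M. of_nat r - l) = 0"
    using sum_fold_shift[of \<delta> M] M by (simp add: kills_def sum\<delta>)
  then have "of_nat r \<in># M"
    by auto
  then obtain M' where M': "M = add_mset (of_nat r) M'"
    by (metis insert_DiffM)
  define w where "w = fold_mset (shift n E) \<delta> M'"
  have w: "\<exists>v<n. w v \<noteq> 0" "\<And>v. v < n \<Longrightarrow> adj n E w v = of_nat r * w v"
    using eig[OF M' w_def] by auto
  have w_int: "w v \<in> \<int>" for v
    unfolding w_def using ev M' by (intro fold_shift_Ints) (auto simp: \<delta>_def)
  then have w_re: "w v = of_real (Re (w v))" for v
    by (metis Ints_cases Re_complex_of_real of_real_of_int_eq)
  have "Re (w u) = Re (w v)" if "u < n" "v < n" for u v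
  proof (rule harmonic_constant[OF conn _ that])
    fix v assume "v < n"
    then show "(\<Sum>u\<in>nbr n E v. Re (w u)) = real r * Re (w v)"
      using w(2)[of v] by (simp add: adj_def flip: Re_sum)
  qed
  then have const: "w v = w 0" if "v < n" for v
    using that n0 w_re by metis
  obtain c where c: "w 0 = of_int c"
    using w_int Ints_cases by blast
  have "c \<noteq> 0"
    using w(1) const c by auto
  define N where "N = image_mset (\<lambda>l. \<lfloor>Re l\<rfloor>) M'"
  have N: "M' = image_mset of_int N"
  proof -
    have "of_int \<lfloor>Re l\<rfloor> = l" if "l \<in># M'" for l
      using ev[of l] that M' by (auto elim!: Ints_cases)
    then show ?thesis
      by (simp add: N_def multiset.map_comp comp_def multiset.map_ident_strong)
  qed
  \<comment> \<open>The sum of the entries of \<open>w\<close>, computed from its values and from its construction.\<close>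
  have "of_int (int n * c) = (\<Sum>v<n. w v)"
    using const c by simp
  also have "\<dots> = (\<Prod>l\<in>#M'. of_nat r - l)"
    using sum_fold_shift[of \<delta> M'] by (simp add: w_def sum\<delta>)
  also have "\<dots> = (of_int (\<Prod>l\<in>#N. int r - l) :: complex)"
    unfolding N by (induction N) auto
  finally have prod: "int n * c = (\<Prod>l\<in>#N. int r - l)"
    using of_int_eq_iff by blast
  then have "int n dvd (\<Prod>l\<in>#N. int r - l)"
    by (metis dvd_triv_left)
  then obtain l where l: "l \<in># N" "int n dvd int r - l"
    using \<open>prime n\<close> by (auto simp: prime_dvd_prod_mset_iff)
  have "(\<Prod>l\<in>#N. int r - l) \<noteq> 0"
    using prod \<open>c \<noteq> 0\<close> n0 by (metis mult_eq_0_iff of_nat_eq_0_iff less_irrefl)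
  with l have "int r - l \<noteq> 0"
    by auto
  with l(2) have "int n \<le> \<bar>int r - l\<bar>"
    using dvd_imp_le_int[of "int r - l" "int n"] by simp
  moreover have "\<bar>l\<bar> \<le> int r"
  proof -
    have "of_int l \<in># M'"
      using l(1) by (subst N) simp
    have "norm (of_int l :: complex) \<le> real r"
      using ev[of "of_int l"] \<open>of_int l \<in># M'\<close> M' by simp
    then show ?thesis by (simp add: norm_of_int)
  qed
  ultimately show ?thesis by linarith
qed

end


section \<open>Constructing regular integral graphs\<close>

definition complement_rel :: "(nat \<Rightarrow> nat \<Rightarrow> bool) \<Rightarrow> nat \<Rightarrow> nat \<Rightarrow> bool" where
  "complement_rel E u v \<longleftrightarrow> u \<noteq> v \<and> \<not> E u v"

definition union_rel ::
    "nat \<Rightarrow> (nat \<Rightarrow> nat \<Rightarrow> bool) \<Rightarrow> (nat \<Rightarrow> nat \<Rightarrow> bool) \<Rightarrow> nat \<Rightarrow> nat \<Rightarrow> bool" where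
  "union_rel n E F u v \<longleftrightarrow>
     (if u < n then v < n \<and> E u v else n \<le> v \<and> F (u - n) (v - n))"

definition realizable :: "nat \<Rightarrow> nat \<Rightarrow> bool" where
  "realizable n r \<longleftrightarrow> (\<exists>E. regular_relation n E r \<and> integral_spectrum n E)"

text \<open>
  An eigenvector of the complement has entry sum zero unless its eigenvalue is the degree. If the
  sum is zero, the complement acts on it as \<open>- 1 - A\<close>.
\<close>

lemma realizable_complement:
  assumes "realizable n r"
  shows "realizable n (n - 1 - r)"
proof -
  obtain E where "regular_relation n E r" and int: "integral_spectrum n E"
    using assms by (auto simp: realizable_def)
  interpret regular_relation n E r by fact
  let ?F = "complement_rel E"
  have nbr: "nbr n ?F v = {..<n} - insert v (nbr n E v)" for v
    by (auto simp: nbr_def complement_rel_def)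
  have sub: "insert v (nbr n E v) \<subseteq> {..<n}" if "v < n" for v
    using that by (auto simp: nbr_def)
  have notin: "v \<notin> nbr n E v" for v
    by (simp add: nbr_def irrefl)
  interpret F: regular_relation n ?F "n - 1 - r"
  proof
    fix v assume "v < n"
    then show "card (nbr n ?F v) = n - 1 - r"
      using sub degree notin by (simp add: nbr card_Diff_subset)
  qed (auto simp: complement_rel_def sym)
  have "integral_spectrum n ?F"
    unfolding integral_spectrum_def
  proof (intro allI impI)
    fix k f
    assume "\<exists>v<n. f v \<noteq> 0" and eig: "\<forall>v<n. adj n ?F f v = k * f v"
    then obtain x where x: "x < n" "f x \<noteq> 0" by auto
    let ?S = "\<Sum>v<n. f v"
    have "of_nat (n - 1 - r) * ?S = (\<Sum>v<n. k * f v)"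
      unfolding F.sum_adj [symmetric] using eig by (intro sum.cong) auto
    also have "\<dots> = k * ?S"
      by (simp add: sum_distrib_left)
    finally have "k = of_nat (n - 1 - r) \<or> ?S = 0"
      by auto
    then show "k \<in> \<int>"
    proof
      assume S: "?S = 0"
      have "adj n E f v = (- 1 - k) * f v" if "v < n" for v
      proof -
        have "adj n ?F f v = ?S - (f v + adj n E f v)"
          unfolding adj_def nbr using sub[OF that] notin by (subst sum_diff) auto
        then show ?thesis
          using eig S that by (auto simp: algebra_simps)
      qed
      then have "- 1 - k \<in> \<int>"
        using integral_spectrumD[OF int, of x f] x by blast
      then have "- 1 - (- 1 - k) \<in> \<int>"
        by (intro Ints_diff) auto
      then show ?thesis by simp
    qed (simp del: of_nat_diff)
  qed
  then show ?thesis
    unfolding realizable_def using F.regular_relation_axioms by blast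
qed

text \<open>
  An eigenvector of the union is nonzero on one of the two parts, and its restriction to that part
  is an eigenvector for the same eigenvalue.
\<close>

lemma realizable_union:
  assumes "realizable m r" "realizable n r"
  shows "realizable (m + n) r"
proof -
  obtain E F where "regular_relation m E r" and intE: "integral_spectrum m E"
    and "regular_relation n F r" and intF: "integral_spectrum n F"
    using assms by (auto simp: realizable_def)
  interpret E: regular_relation m E r by fact
  interpret F: regular_relation n F r by fact
  let ?U = "union_rel m E F"
  have low: "nbr (m + n) ?U v = nbr m E v" if "v < m" for v
    using that by (auto simp: nbr_def union_rel_def)
  have high: "nbr (m + n) ?U (m + v) = (+) m ` nbr n F v" for v
  proof (intro equalityI subsetI)
    fix u assume "u \<in> nbr (m + n) ?U (m + v)"
    then show "u \<in> (+) m ` nbr n F v"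
      by (intro image_eqI[of _ _ "u - m"]) (auto simp: nbr_def union_rel_def)
  qed (auto simp: nbr_def union_rel_def)
  have "regular_relation (m + n) ?U r"
  proof
    fix v assume v: "v < m + n"
    show "card (nbr (m + n) ?U v) = r"
    proof (cases "v < m")
      case True
      then show ?thesis by (simp add: low E.degree)
    next
      case False
      then have "card (nbr (m + n) ?U (m + (v - m))) = r"
        unfolding high using v by (subst card_image) (auto simp: F.degree)
      then show ?thesis using False by simp
    qed
  qed (auto simp: union_rel_def E.sym F.sym E.irrefl F.irrefl split: if_splits)
  moreover have "integral_spectrum (m + n) ?U"
    unfolding integral_spectrum_def
  proof (intro allI impI)
    fix k f
    assume "\<exists>v<m + n. f v \<noteq> 0" and eig: "\<forall>v<m + n. adj (m + n) ?U f v = k * f v"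
    then obtain x where x: "x < m + n" "f x \<noteq> 0" by auto
    show "k \<in> \<int>"
    proof (cases "x < m")
      case True
      have "adj m E f v = k * f v" if "v < m" for v
        using eig[rule_format, of v] that by (simp add: adj_def low)
      then show ?thesis
        using integral_spectrumD[OF intE True, of f] x by blast
    next
      case False
      have "adj n F (\<lambda>v. f (m + v)) v = k * f (m + v)" if "v < n" for v
      proof -
        have "adj (m + n) ?U f (m + v) = adj n F (\<lambda>v. f (m + v)) v"
          unfolding adj_def high by (subst sum.reindex) auto
        then show ?thesis
          using eig that by auto
      qed
      then show ?thesis
        using integral_spectrumD[OF intF, of "x - m" "\<lambda>v. f (m + v)"] x False by auto
    qed
  qed
  ultimately show ?thesis
    unfolding realizable_def by blast
qed

lemma realizable_edgeless: "realizable n 0"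
proof -
  have "regular_relation n (\<lambda>_ _. False) 0"
    by standard (auto simp: nbr_def)
  moreover have "integral_spectrum n (\<lambda>_ _. False)"
    by (auto simp: integral_spectrum_def adj_def nbr_def)
  ultimately show ?thesis
    unfolding realizable_def by blast
qed

lemma realizable_complete: "realizable n (n - 1)"
  using realizable_complement[OF realizable_edgeless, of n] by simp

text \<open>
  The cocktail party graph is the complement of a perfect matching, which is a union of copies of
  \<open>K\<^sub>2\<close>.
\<close>

lemma realizable_cocktail_party: "realizable (2 * m) (2 * m - 2)"
proof -
  have "realizable (2 * m) 1"
  proof (induction m)
    case 0
    show ?case
      by (auto simp: realizable_def regular_relation_def integral_spectrum_def
          intro!: exI[of _ "\<lambda>_ _. False"])
  next
    case (Suc m)
    then show ?case
      using realizable_union[OF realizable_complete[of 2]] by simp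
  qed
  from realizable_complement[OF this] show ?thesis by (simp add: numeral_2_eq_2)
qed

text \<open>
  In terms of \<open>A = r + 1\<close> and \<open>B = n - r\<close>, the parity hypothesis says that \<open>n r\<close> is even. It is
  symmetric in \<open>A\<close> and \<open>B\<close> and invariant under subtracting \<open>A\<close> from \<open>B\<close>. At \<open>B = 2 A\<close> it forces
  \<open>A\<close> to be odd, so that \<open>A + 1\<close> is the order of a cocktail party graph of degree \<open>A - 1\<close>.
\<close>

lemma realizable_pair:
  assumes "A > 0" "B > 0" "odd A \<or> odd B" "A \<noteq> B \<or> A = 1"
  shows "realizable (A + B - 1) (A - 1)"
  using assms
proof (induction "A + B" arbitrary: A B rule: less_induct)
  case less
  have ordered: "realizable (A + B - 1) (A - 1)"
    if le: "A \<le> B" "A + B = N" and AB: "A > 0" "B > 0" "odd A \<or> odd B" "A \<noteq> B \<or> A = 1"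
      and IH: "\<And>C D. C + D < N \<Longrightarrow> C > 0 \<Longrightarrow> D > 0 \<Longrightarrow> odd C \<or> odd D \<Longrightarrow> C \<noteq> D \<or> C = 1
        \<Longrightarrow> realizable (C + D - 1) (C - 1)"
    for A B N :: nat
  proof -
    consider "A = 1" | "A > 1" "B = 2 * A" | "A > 1" "B \<noteq> 2 * A" "A < B"
      using AB le by linarith
    then show ?thesis
    proof cases
      case 1
      then show ?thesis using realizable_edgeless by simp
    next
      case 2
      then have "even (A + 1)"
        using AB by auto
      then obtain m where m: "A + 1 = 2 * m"
        by (elim evenE)
      have "realizable (A + (A - 1) - 1) (A - 1)"
        using 2 AB le by (intro IH) auto
      moreover have "realizable (A + 1) (A - 1)"
        using realizable_cocktail_party[of m] m by (metis add_diff_cancel_right nat_1_add_1)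
      ultimately have "realizable ((A + (A - 1) - 1) + (A + 1)) (A - 1)"
        by (rule realizable_union)
      moreover have "(A + (A - 1) - 1) + (A + 1) = A + B - 1"
        using 2 by simp
      ultimately show ?thesis by (simp only:)
    next
      case 3
      have "realizable (A + (B - A) - 1) (A - 1)"
        using 3 AB le by (intro IH) auto
      then have "realizable ((A + (B - A) - 1) + A) (A - 1)"
        using realizable_complete[of A] by (rule realizable_union)
      moreover have "(A + (B - A) - 1) + A = A + B - 1"
        using 3 by simp
      ultimately show ?thesis by (simp only:)
    qed
  qed
  show ?case
  proof (cases "A \<le> B")
    case True
    then show ?thesis
      by (rule ordered[OF _ refl]) (use less in auto)
  next
    case False
    have "realizable (B + A - 1) (B - 1)"
      by (rule ordered[OF _ refl]) (use less False in \<open>auto simp: add.commute\<close>)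
    from realizable_complement[OF this] show ?thesis
      using less.prems by (simp add: add.commute)
  qed
qed

section \<open>Translation to graphs on an initial segment of the natural numbers\<close>

lemma eigenvalue_adjacency_matrix_iff:
  "eigenvalue (adjacency_matrix n G) k \<longleftrightarrow>
     (\<exists>f. (\<exists>v<n. f v \<noteq> 0) \<and> (\<forall>v<n. adj n (\<lambda>u v. (u, v) \<in> parcs G) f v = k * f v))"
proof -
  let ?E = "\<lambda>u v. (u, v) \<in> parcs G"
  let ?A = "adjacency_matrix n G"
  have dim: "dim_row ?A = n"
    by (simp add: adjacency_matrix_def)
  have mult: "(?A *\<^sub>v x) $ v = adj n ?E (\<lambda>u. x $ u) v" if "x \<in> carrier_vec n" "v < n" for x v
  proof -
    have "nbr n ?E v = {0..<n} \<inter> {u. ?E v u}"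
      by (auto simp: nbr_def)
    then show ?thesis
      using that by (simp add: adjacency_matrix_def scalar_prod_def adj_def sum.If_cases
          if_distrib[of "\<lambda>a. a * _"] cong: if_cong)
  qed
  show ?thesis
  proof
    assume "eigenvalue ?A k"
    then obtain x where x: "x \<in> carrier_vec n" "x \<noteq> 0\<^sub>v n" "?A *\<^sub>v x = k \<cdot>\<^sub>v x"
      by (auto simp: eigenvalue_def eigenvector_def dim)
    have "\<exists>v<n. x $ v \<noteq> 0"
      using x(1,2) by (metis carrier_vecD eq_vecI index_zero_vec)
    moreover have "\<forall>v<n. adj n ?E (\<lambda>u. x $ u) v = k * x $ v"
      using x mult by (metis carrier_vecD index_smult_vec(1))
    ultimately show "\<exists>f. (\<exists>v<n. f v \<noteq> 0) \<and> (\<forall>v<n. adj n ?E f v = k * f v)"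
      by blast
  next
    assume "\<exists>f. (\<exists>v<n. f v \<noteq> 0) \<and> (\<forall>v<n. adj n ?E f v = k * f v)"
    then obtain f v where f: "v < n" "f v \<noteq> 0" "\<forall>v<n. adj n ?E f v = k * f v"
      by auto
    let ?x = "vec n f"
    have "?x \<noteq> 0\<^sub>v n"
      using f by (metis index_vec index_zero_vec(1))
    moreover have "?A *\<^sub>v ?x = k \<cdot>\<^sub>v ?x"
    proof (rule eq_vecI)
      fix u assume "u < dim_vec (k \<cdot>\<^sub>v ?x)"
      then have "u < n" by simp
      then have "(?A *\<^sub>v ?x) $ u = adj n ?E (\<lambda>u. ?x $ u) u"
        by (intro mult) auto
      also have "\<dots> = adj n ?E f u"
        unfolding adj_def by (intro sum.cong) (auto simp: nbr_def)
      finally show "(?A *\<^sub>v ?x) $ u = (k \<cdot>\<^sub>v ?x) $ u"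
        using f \<open>u < n\<close> by simp
    qed (simp add: dim)
    ultimately show "eigenvalue ?A k"
      unfolding eigenvalue_def eigenvector_def dim by (intro exI[of _ ?x]) auto
  qed
qed

lemma integral_graph_iff:
  "integral_graph n G \<longleftrightarrow> integral_spectrum n (\<lambda>u v. (u, v) \<in> parcs G)"
  unfolding integral_graph_def integral_spectrum_def eigenvalue_adjacency_matrix_iff by blast

lemma out_degree_eq:
  assumes "G \<in> labelled_graphs n"
  shows "out_degree (with_proj G) v = card (nbr n (\<lambda>u v. (u, v) \<in> parcs G) v)"
proof -
  interpret pair_graph G using assms by (simp add: labelled_graphs_def)
  have "out_arcs (with_proj G) v = Pair v ` nbr n (\<lambda>u v. (u, v) \<in> parcs G) v"
    using assms in_arcsD2 by (fastforce simp: out_arcs_def nbr_def labelled_graphs_def)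
  then show ?thesis
    by (simp add: out_degree_def card_image inj_on_def)
qed

lemma regular_integral_graphsD:
  assumes "G \<in> regular_integral_graphs n r"
  shows "regular_relation n (\<lambda>u v. (u, v) \<in> parcs G) r"
    and "integral_spectrum n (\<lambda>u v. (u, v) \<in> parcs G)"
proof -
  have G: "G \<in> labelled_graphs n" "regular r G" "integral_graph n G"
    using assms by (auto simp: regular_integral_graphs_def)
  interpret pair_graph G using G by (simp add: labelled_graphs_def)
  show "regular_relation n (\<lambda>u v. (u, v) \<in> parcs G) r"
  proof
    show "(v, v) \<notin> parcs G" for v
      using pair_no_loops by fastforce
    show "card (nbr n (\<lambda>u v. (u, v) \<in> parcs G) v) = r" if "v < n" for v
      using G that by (auto simp: regular_def labelled_graphs_def out_degree_eq [symmetric])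
  qed (rule arcs_symmetric)
  show "integral_spectrum n (\<lambda>u v. (u, v) \<in> parcs G)"
    using G by (simp add: integral_graph_iff)
qed

lemma regular_integral_graphs_nonempty_iff:
  "regular_integral_graphs n r \<noteq> {} \<longleftrightarrow> realizable n r"
proof
  assume "regular_integral_graphs n r \<noteq> {}"
  then show "realizable n r"
    unfolding realizable_def using regular_integral_graphsD by blast
next
  assume "realizable n r"
  then obtain E where "regular_relation n E r" and int: "integral_spectrum n E"
    by (auto simp: realizable_def)
  interpret regular_relation n E r by fact
  let ?G = "\<lparr>pverts = {0..<n}, parcs = {(u, v). u < n \<and> v < n \<and> E u v}\<rparr>"
  let ?F = "\<lambda>u v. (u, v) \<in> parcs ?G"
  have "finite (parcs ?G)"
    by (rule finite_subset[of _ "{..<n} \<times> {..<n}"]) auto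
  then have "pair_graph ?G"
    by unfold_locales (auto simp: symmetric_def irrefl intro!: symI intro: sym)
  then have G: "?G \<in> labelled_graphs n"
    by (simp add: labelled_graphs_def)
  have nbr: "nbr n ?F v = nbr n E v" if "v < n" for v
    using that by (auto simp: nbr_def)
  have "regular r ?G"
    using nbr degree by (auto simp: regular_def out_degree_eq[OF G])
  moreover have "integral_graph n ?G"
    using int nbr by (simp add: integral_graph_iff integral_spectrum_def adj_def)
  ultimately show "regular_integral_graphs n r \<noteq> {}"
    using G by (auto simp: regular_integral_graphs_def)
qed

lemma connected_iff_rtranclp:
  assumes "G \<in> labelled_graphs n" "n > 0"
  shows "Digraph_Component.connected (with_proj G) \<longleftrightarrow>
    (\<forall>u<n. \<forall>v<n. (\<lambda>a b. b \<in> nbr n (\<lambda>u v. (u, v) \<in> parcs G) a)\<^sup>*\<^sup>* u v)"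
proof -
  interpret pair_graph G using assms by (simp add: labelled_graphs_def)
  have V: "pverts G = {0..<n}"
    using assms by (simp add: labelled_graphs_def)
  have R: "{(a, b). b \<in> nbr n (\<lambda>u v. (u, v) \<in> parcs G) a} = parcs G"
    using in_arcsD2 V by (fastforce simp: nbr_def)
  have "(parcs G)\<^sup>s = parcs G"
    using arcs_symmetric by (auto simp: symcl_def)
  moreover have "(u, v) \<in> rtrancl_on (pverts G) (parcs G) \<longleftrightarrow> (u, v) \<in> (parcs G)\<^sup>*"
    if "u < n" "v < n" for u v
  proof
    assume "(u, v) \<in> (parcs G)\<^sup>*"
    then show "(u, v) \<in> rtrancl_on (pverts G) (parcs G)"
      by (rule rtrancl_consistent_rtrancl_on) (use that V in_arcsD1 in_arcsD2 in auto)
  qed (rule rtrancl_on_rtranclI)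
  ultimately show ?thesis
    using assms(2) by (auto simp: connected_conv V rtranclp_rtrancl_eq R)
qed

lemma card_quotient_iso_rel_pos_iff:
  assumes "S \<subseteq> labelled_graphs n"
  shows "card (S // iso_rel S) > 0 \<longleftrightarrow> S \<noteq> {}"
proof -
  have "finite (S // iso_rel S)"
    using finite_subset[OF assms finite_labelled_graphs]
    by (rule finite_quotient) (auto simp: iso_rel_def)
  then show ?thesis
    by (auto simp: card_gt_0_iff quotient_def)
qed

lemma rl_pos_iff: "rl n r > 0 \<longleftrightarrow> realizable n r"
  unfolding rl_def regular_integral_graphs_nonempty_iff [symmetric]
  by (rule card_quotient_iso_rel_pos_iff) (auto simp: regular_integral_graphs_def)

lemma crl_pos_iff: "crl n r > 0 \<longleftrightarrow> connected_regular_integral_graphs n r \<noteq> {}"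
  unfolding crl_def
  by (rule card_quotient_iso_rel_pos_iff)
    (auto simp: connected_regular_integral_graphs_def regular_integral_graphs_def)

section \<open>Prime order\<close>

theorem corollary7:
  fixes n r :: nat
  assumes "prime n" and "n \<ge> 3" and "r \<in> {0..n - 1}"
  shows "(rl n r > 0 \<longleftrightarrow> even r \<and> real r \<noteq> (real n - 1) / 2) \<and>
         (crl n r > 0 \<longleftrightarrow> even r \<and> real r > (real n - 1) / 2)"
proof -
  have odd: "odd n"
    using assms prime_odd_nat by auto
  have half: "real r \<noteq> (real n - 1) / 2 \<longleftrightarrow> n \<noteq> 2 * r + 1"
    "real r > (real n - 1) / 2 \<longleftrightarrow> 2 * r + 1 > n"
    using of_nat_eq_iff[of n "2 * r + 1", where 'a = real]
      of_nat_less_iff[of n "2 * r + 1", where 'a = real]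
    by auto
  have labelled: "G \<in> labelled_graphs n" if "G \<in> regular_integral_graphs n r" for G
    using that by (simp add: regular_integral_graphs_def)
  have even: "even r" if "realizable n r"
    using that odd regular_relation.even_order_times_degree
    by (fastforce simp: realizable_def)
  have "n \<noteq> 2 * r + 1" if real: "realizable n r"
  proof
    assume n: "n = 2 * r + 1"
    obtain E where E: "regular_relation n E r" "integral_spectrum n E"
      using real by (auto simp: realizable_def)
    have "n \<le> 2 * r"
      using regular_relation.dense_connected[OF E(1)] n
      by (intro regular_relation.connected_integral_prime_order[OF E(1) _ E(2) assms(1)]) auto
    with n show False by simp
  qed
  moreover have realize: "realizable n r" if "even r" "n \<noteq> 2 * r + 1"
    using realizable_pair[of "r + 1" "n - r"] that assms by auto
  ultimately have rl: "rl n r > 0 \<longleftrightarrow> even r \<and> n \<noteq> 2 * r + 1"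
    using even by (auto simp: rl_pos_iff)
  have "crl n r > 0 \<longleftrightarrow> even r \<and> 2 * r + 1 > n"
  proof
    assume "crl n r > 0"
    then obtain G where G: "G \<in> regular_integral_graphs n r" "Digraph_Component.connected (with_proj G)"
      by (auto simp: crl_pos_iff connected_regular_integral_graphs_def)
    have "n \<le> 2 * r"
      using connected_iff_rtranclp[OF labelled[OF G(1)]] G(2) assms
      by (intro regular_relation.connected_integral_prime_order[OF regular_integral_graphsD(1)[OF G(1)]
            _ regular_integral_graphsD(2)[OF G(1)]]) auto
    moreover have "realizable n r"
      using G(1) regular_integral_graphs_nonempty_iff by blast
    ultimately show "even r \<and> 2 * r + 1 > n"
      using even by simp
  next
    assume r: "even r \<and> 2 * r + 1 > n"
    then have "realizable n r"
      by (intro realize) auto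
    then obtain G where G: "G \<in> regular_integral_graphs n r"
      using regular_integral_graphs_nonempty_iff by blast
    have "Digraph_Component.connected (with_proj G)"
      using regular_relation.dense_connected[OF regular_integral_graphsD(1)[OF G]] r assms
      by (subst connected_iff_rtranclp[OF labelled[OF G]]) auto
    with G show "crl n r > 0"
      by (auto simp: crl_pos_iff connected_regular_integral_graphs_def)
  qed
  with rl show ?thesis
    unfolding half by blast
qed

end
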